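(* Let $X,Y$ be independent identically distributed $\mathbb{R}^d$-valued random vectors with independent entries. If $0<a/2<b$, then $$\mathbb{P}(\|X+Y\|_\infty\le b)<\left(\lceil 2b/a\rceil\right)^d\cdot \mathbb{P}(\|X-Y\|_\infty\le a).$$ For all $a,b>0$, $$\mathbb{P}(\|X-Y\|_\infty\le b)<\left(2\lceil b/a\rceil-1\right)^d\cdot \mathbb{P}(\|X-Y\|_\infty\le a).$$
   Context: $\lceil t\rceil$ denotes the smallest integer greater than or equal to $t$. For $x=(x_1,\dots,x_d)\in\mathbb{R}^d$ with $d\ge 1$, $\|x\|_\infty=\max_{1\le i\le d}|x_i|$. "Independent entries" means that the $d$ coordinates of $X$ are mutually independent, and likewise for $Y$.
   Formalization: The second inequality is proved with ≤ for all a,b>0 and with strict < only when b>a; strictness fails in general for b≤a (for b=a both sides are equal; for b<a and X=Y constant it reads 1<1). *)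

theory Defs
  imports "HOL-Probability.Probability"
begin

end

theory Submission imports Defs begin

text \<open>
  By independence of the coordinates both sides are products, so everything reduces to strict
  inequalities for two independent copies of a real random variable with law \<open>N\<close>, i.e. to the
  positivity of the quadratic form of a symmetric kernel such as
  \<open>G x y = K * of_bool (\<bar>x - y\<bar> \<le> a) - of_bool (\<bar>x - y\<bar> \<le> b)\<close>.

  Suppose the form is nonpositive at \<open>N\<close>. Among the densities \<open>0 \<le> h \<le> 1\<close> some nonzero \<open>h\<close> cannot be
  shrunk so that both form and mass decrease, whence \<open>\<integral>y. G x y * h y \<partial>N \<le> 0\<close> for almost every \<open>x\<close>
  charged by \<open>h\<close>. Let \<open>x\<close> nearly maximise the \<open>h\<close>-mass of \<open>{x - a..x + a}\<close>, with supremum \<open>s\<close>. An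
  interval of length \<open>a\<close> has mass at most \<open>s\<close>, and the interval of radius \<open>b\<close> (about \<open>x\<close>, or about \<open>- x\<close>
  for sums) is covered by so few of these that each must have mass close to \<open>s\<close>. This yields a near
  maximiser to the right of \<open>x\<close> with mass at least \<open>s / 2\<close> in between, and iteration contradicts
  finiteness of the measure.
\<close>

section \<open>Quadratic forms of bounded symmetric kernels and minimal densities\<close>

definition quad_form :: "'a measure \<Rightarrow> ('a \<Rightarrow> 'a \<Rightarrow> real) \<Rightarrow> ('a \<Rightarrow> real) \<Rightarrow> real" where
  "quad_form M G h = (\<integral>p. G (fst p) (snd p) * (h (fst p) * h (snd p)) \<partial>(M \<Otimes>\<^sub>M M))"

text \<open>The bounds are imposed at every point rather than almost everywhere, so that they pass
  to pointwise limits directly.\<close>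

definition unit_densities :: "'a measure \<Rightarrow> ('a \<Rightarrow> real) set" where
  "unit_densities M = {h \<in> borel_measurable M. \<forall>x. 0 \<le> h x \<and> h x \<le> 1}"

text \<open>A bounded kernel on a finite measure space makes the bilinear integrals converge, so
  that Fubini applies. Symmetry merges the two cross terms when the form is expanded at a perturbed
  density.\<close>

locale bounded_kernel = finite_measure M for M :: "'a measure" +
  fixes G :: "'a \<Rightarrow> 'a \<Rightarrow> real" and C :: real
  assumes meas_G: "(\<lambda>p. G (fst p) (snd p)) \<in> borel_measurable (M \<Otimes>\<^sub>M M)"
    and bound_G: "\<And>x y. \<bar>G x y\<bar> \<le> C"
    and sym_G: "\<And>x y. G x y = G y x"
begin

sublocale pair: pair_sigma_finite M M ..

sublocale prod: finite_measure "M \<Otimes>\<^sub>M M"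
  by (rule finite_measure_pair_measure) unfold_locales

lemma C_nonneg: "0 \<le> C"
  using bound_G[of undefined undefined] by linarith

lemma integrable_bilinear:
  assumes [measurable]: "u \<in> borel_measurable M" "v \<in> borel_measurable M"
    and "\<And>x. \<bar>u x\<bar> \<le> 1" "\<And>x. \<bar>v x\<bar> \<le> 1"
  shows "integrable (M \<Otimes>\<^sub>M M) (\<lambda>p. G (fst p) (snd p) * (u (fst p) * v (snd p)))"
proof (rule prod.integrable_const_bound[where B = C])
  note [measurable] = meas_G
  show "(\<lambda>p. G (fst p) (snd p) * (u (fst p) * v (snd p))) \<in> borel_measurable (M \<Otimes>\<^sub>M M)"
    by measurable
  have "\<bar>G x y * (u x * v y)\<bar> \<le> C" for x y
  proof -
    have "\<bar>u x\<bar> * \<bar>v y\<bar> \<le> 1 * 1"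
      using assms(3,4) by (intro mult_mono) auto
    then have "\<bar>G x y\<bar> * (\<bar>u x\<bar> * \<bar>v y\<bar>) \<le> C * 1"
      using bound_G C_nonneg by (intro mult_mono) auto
    then show ?thesis by (simp add: abs_mult)
  qed
  then show "AE p in M \<Otimes>\<^sub>M M. norm (G (fst p) (snd p) * (u (fst p) * v (snd p))) \<le> C"
    by simp
qed

lemma integral_bilinear:
  assumes [measurable]: "u \<in> borel_measurable M" "v \<in> borel_measurable M"
    and "\<And>x. \<bar>u x\<bar> \<le> 1" "\<And>x. \<bar>v x\<bar> \<le> 1"
  shows "(\<integral>p. G (fst p) (snd p) * (u (fst p) * v (snd p)) \<partial>(M \<Otimes>\<^sub>M M))
         = (\<integral>x. u x * (\<integral>y. G x y * v y \<partial>M) \<partial>M)"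
proof -
  have "(\<integral>x. u x * (\<integral>y. G x y * v y \<partial>M) \<partial>M) = (\<integral>x. (\<integral>y. G x y * (u x * v y) \<partial>M) \<partial>M)"
    by (intro Bochner_Integration.integral_cong refl)
       (simp add: mult.left_commute flip: integral_mult_right_zero)
  also have "\<dots> = (\<integral>p. (case p of (x, y) \<Rightarrow> G x y * (u x * v y)) \<partial>(M \<Otimes>\<^sub>M M))"
    using pair.integral_fst'[OF integrable_bilinear[OF assms]] by (simp add: case_prod_beta)
  finally show ?thesis by (simp add: case_prod_beta)
qed

lemma integral_bilinear_swap:
  assumes [measurable]: "u \<in> borel_measurable M" "v \<in> borel_measurable M"
    and "\<And>x. \<bar>u x\<bar> \<le> 1" "\<And>x. \<bar>v x\<bar> \<le> 1"
  shows "(\<integral>p. G (fst p) (snd p) * (u (fst p) * v (snd p)) \<partial>(M \<Otimes>\<^sub>M M))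
         = (\<integral>p. G (fst p) (snd p) * (v (fst p) * u (snd p)) \<partial>(M \<Otimes>\<^sub>M M))"
proof -
  note [measurable] = meas_G
  have "(\<integral>p. G (snd p) (fst p) * (u (snd p) * v (fst p)) \<partial>(M \<Otimes>\<^sub>M M))
      = (\<integral>p. G (fst p) (snd p) * (u (fst p) * v (snd p)) \<partial>(M \<Otimes>\<^sub>M M))"
    using pair.integral_product_swap[of "\<lambda>p. G (fst p) (snd p) * (u (fst p) * v (snd p))"]
    by (simp add: case_prod_beta')
  moreover have "G (snd p) (fst p) * (u (snd p) * v (fst p)) = G (fst p) (snd p) * (v (fst p) * u (snd p))" for p
    using sym_G[of "snd p" "fst p"] by simp
  ultimately show ?thesis by simp
qed

text \<open>If the potential of \<open>h\<close> is positive on a set charged by \<open>h\<close>, removing a small fraction of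
  the mass there decreases the quadratic form to first order.\<close>
lemma potential_pos_shrink:
  assumes h: "h \<in> unit_densities M"
    and neg: "\<not> (AE x in M. 0 < h x \<longrightarrow> (\<integral>y. G x y * h y \<partial>M) \<le> 0)"
  shows "\<exists>h' \<in> unit_densities M. (\<forall>x. h' x \<le> h x) \<and> quad_form M G h' < quad_form M G h
            \<and> (\<integral>x. h' x \<partial>M) < (\<integral>x. h x \<partial>M)"
proof -
  note [measurable] = meas_G
  define f where "f x = (\<integral>y. G x y * h y \<partial>M)" for x
  have hm[measurable]: "h \<in> borel_measurable M" and h01: "0 \<le> h x" "h x \<le> 1" for x
    using h by (auto simp: unit_densities_def)
  have fm[measurable]: "f \<in> borel_measurable M"
    unfolding f_def by measurable
  \<comment> \<open>\<open>u\<close> is the part of \<open>h\<close> that sits where its potential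
    \<open>f\<close> is positive. Removing \<open>t * u\<close> changes the form by
    \<open>- 2 * t * \<alpha>\<close> to first order, with \<open>\<alpha>\<close> as defined
    below.\<close>
  define u where "u x = (if 0 < f x then h x else 0)" for x
  have um[measurable]: "u \<in> borel_measurable M" unfolding u_def by measurable
  have u01: "0 \<le> u x" "u x \<le> h x" "u x \<le> 1" for x using h01 by (auto simp: u_def)
  have b1: "\<bar>u x\<bar> \<le> 1" "\<bar>h x\<bar> \<le> 1" for x using u01[of x] h01[of x] by auto
  have fb: "\<bar>f x\<bar> \<le> C * measure M (space M)" for x
  proof (cases "integrable M (\<lambda>y. G x y * h y)")
    case True
    have "\<bar>G x y\<bar> * \<bar>h y\<bar> \<le> C * 1" for y
      using bound_G b1 C_nonneg by (intro mult_mono) auto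
    then have "(\<integral>y. \<bar>G x y * h y\<bar> \<partial>M) \<le> (\<integral>y. C \<partial>M)"
      using True integrable_abs[OF True] by (intro integral_mono) (auto simp: abs_mult)
    then have "\<bar>f x\<bar> \<le> (\<integral>y. C \<partial>M)"
      unfolding f_def using integral_abs_bound by (rule order_trans[rotated])
    then show ?thesis by (simp add: mult.commute)
  next
    \<comment> \<open>The Bochner integral of a non-integrable function is 0 by convention, so the
      bound holds here as well.\<close>
    case False
    then show ?thesis using C_nonneg by (simp add: f_def not_integrable_integral_eq)
  qed
  define \<alpha> where "\<alpha> = (\<integral>x. u x * f x \<partial>M)"
  have int_uf: "integrable M (\<lambda>x. u x * f x)"
  proof (rule integrable_const_bound[where B = "C * measure M (space M)"])
    have "\<bar>u x * f x\<bar> \<le> 1 * (C * measure M (space M))" for x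
      unfolding abs_mult using b1 fb by (intro mult_mono) auto
    then show "AE x in M. norm (u x * f x) \<le> C * measure M (space M)" by simp
  qed measurable
  have uf0: "0 \<le> u x * f x" for x using h01 by (simp add: u_def)
  have "\<alpha> \<noteq> 0"
  proof
    assume "\<alpha> = 0"
    then have "AE x in M. u x * f x = 0"
      unfolding \<alpha>_def using integral_nonneg_eq_0_iff_AE[OF int_uf] uf0 by auto
    then have "AE x in M. 0 < h x \<longrightarrow> f x \<le> 0"
      by eventually_elim (auto simp: u_def split: if_splits)
    with neg show False by (simp add: f_def)
  qed
  moreover have "0 \<le> \<alpha>" unfolding \<alpha>_def using uf0 by simp
  ultimately have \<alpha>: "0 < \<alpha>" by simp
  have int_u: "integrable M u" and int_h: "integrable M h"
    by (rule integrable_const_bound[where B = 1]; use b1 in simp)+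
  have mass_u: "0 < (\<integral>x. u x \<partial>M)"
  proof (rule ccontr)
    assume "\<not> ?thesis"
    then have "(\<integral>x. u x \<partial>M) = 0"
      using Bochner_Integration.integral_nonneg[of M u] u01 by fastforce
    then have "AE x in M. u x = 0"
      using integral_nonneg_eq_0_iff_AE[OF int_u] u01 by auto
    then have "AE x in M. u x * f x = 0" by eventually_elim simp
    then have "\<alpha> = 0" unfolding \<alpha>_def by (simp add: integral_eq_zero_AE)
    with \<alpha> show False by simp
  qed
  define D where "D = \<bar>quad_form M G u\<bar>"
  \<comment> \<open>The second-order term is at most \<open>t * (t * D)\<close>, so
    \<open>t * D < 2 * \<alpha>\<close> lets the first-order gain win. The \<open>+ 1\<close> guards
    against \<open>D = 0\<close>, and \<open>t \<le> 1\<close> keeps \<open>h - t * u\<close>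
    nonnegative.\<close>
  define t where "t = min 1 (\<alpha> / (D + 1))"
  have D: "0 \<le> D" by (simp add: D_def)
  have t: "0 < t" "t \<le> 1" "t * D < 2 * \<alpha>"
  proof -
    show "0 < t" "t \<le> 1" using \<alpha> D by (auto simp: t_def)
    have "t * D \<le> \<alpha> / (D + 1) * D" using D by (intro mult_right_mono) (auto simp: t_def)
    also have "\<dots> \<le> \<alpha> * 1" using \<alpha> D by (simp add: field_simps)
    finally show "t * D < 2 * \<alpha>" using \<alpha> by simp
  qed
  define h' where "h' x = h x - t * u x" for x
  have tu: "0 \<le> t * u x" "t * u x \<le> h x" for x
    using t u01[of x] mult_left_le_one_le[of "u x" t] by (auto intro: order_trans)
  have h': "h' \<in> unit_densities M" "h' x \<le> h x" for x
  proof -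
    have "h' \<in> borel_measurable M" unfolding h'_def by measurable
    moreover have "h x - t * u x \<le> 1" for x using tu(1)[of x] h01(2)[of x] by linarith
    ultimately show "h' \<in> unit_densities M" using tu by (auto simp: unit_densities_def h'_def)
  qed (use tu in \<open>simp add: h'_def\<close>)
  have "quad_form M G h' = (\<integral>p. G (fst p) (snd p) * (h (fst p) * h (snd p))
      - t * (G (fst p) (snd p) * (u (fst p) * h (snd p)))
      - t * (G (fst p) (snd p) * (h (fst p) * u (snd p)))
      + t\<^sup>2 * (G (fst p) (snd p) * (u (fst p) * u (snd p))) \<partial>(M \<Otimes>\<^sub>M M))"
    unfolding quad_form_def h'_def
    by (intro Bochner_Integration.integral_cong refl) (simp add: algebra_simps power2_eq_square)
  also have "\<dots> = quad_form M G h - t * (\<integral>p. G (fst p) (snd p) * (u (fst p) * h (snd p)) \<partial>(M \<Otimes>\<^sub>M M))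
      - t * (\<integral>p. G (fst p) (snd p) * (h (fst p) * u (snd p)) \<partial>(M \<Otimes>\<^sub>M M)) + t\<^sup>2 * quad_form M G u"
    unfolding quad_form_def using integrable_bilinear b1 by simp
  also have "(\<integral>p. G (fst p) (snd p) * (h (fst p) * u (snd p)) \<partial>(M \<Otimes>\<^sub>M M))
      = (\<integral>p. G (fst p) (snd p) * (u (fst p) * h (snd p)) \<partial>(M \<Otimes>\<^sub>M M))"
    by (rule integral_bilinear_swap) (use b1 in auto)
  also have "(\<integral>p. G (fst p) (snd p) * (u (fst p) * h (snd p)) \<partial>(M \<Otimes>\<^sub>M M)) = \<alpha>"
    unfolding \<alpha>_def f_def by (rule integral_bilinear) (use b1 in auto)
  finally have "quad_form M G h' = quad_form M G h - t * (2 * \<alpha>) + t * (t * quad_form M G u)"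
    by (simp add: power2_eq_square)
  moreover have "t * (t * quad_form M G u) \<le> t * (t * D)"
    using t by (intro mult_left_mono) (auto simp: D_def)
  moreover have "t * (t * D) < t * (2 * \<alpha>)" using t by simp
  ultimately have "quad_form M G h' < quad_form M G h" by linarith
  moreover have "(\<integral>x. h' x \<partial>M) < (\<integral>x. h x \<partial>M)"
    unfolding h'_def using int_u int_h t mass_u by simp
  ultimately show ?thesis using h' by blast
qed

text \<open>Greedy descent: each stage shrinks the current density, without raising the form, to
  within \<open>(1/2)^n\<close> of the least mass attainable in this way. The sequence decreases
  pointwise. If its limit could be shrunk by \<open>potential_pos_shrink\<close>, the result would
  compete at every stage and undercut the limiting mass.\<close>

lemma minimal_density:
  assumes h0: "h0 \<in> unit_densities M"
  shows "\<exists>h \<in> unit_densities M. quad_form M G h \<le> quad_form M G h0 \<and>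
    (AE x in M. 0 < h x \<longrightarrow> (\<integral>y. G x y * h y \<partial>M) \<le> 0)"
proof -
  define I where "I h = (\<integral>x. h x \<partial>M)" for h :: "'a \<Rightarrow> real"
  define S where "S h = {h' \<in> unit_densities M. (\<forall>x. h' x \<le> h x) \<and> quad_form M G h' \<le> quad_form M G h}"
    for h
  have I0: "0 \<le> I h" if "h \<in> unit_densities M" for h
    using that by (auto simp: I_def unit_densities_def)
  have ex: "\<exists>h' \<in> S h. \<forall>k \<in> S h. I h' \<le> I k + (1/2)^n" if h: "h \<in> unit_densities M" for h and n :: nat
  proof -
    have ne: "I ` S h \<noteq> {}" using h by (auto simp: S_def)
    have bdd: "bdd_below (I ` S h)" using I0 by (auto simp: S_def intro!: bdd_belowI[of _ 0])
    have "Inf (I ` S h) < Inf (I ` S h) + (1/2)^n" by simp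
    then obtain h' where "h' \<in> S h" "I h' < Inf (I ` S h) + (1/2)^n"
      unfolding cInf_less_iff[OF ne bdd] by blast
    moreover have "Inf (I ` S h) \<le> I k" if "k \<in> S h" for k
      using that bdd by (simp add: cInf_lower)
    ultimately show ?thesis by (intro bexI[of _ h'] ballI) fastforce+
  qed
  have "\<exists>H. \<forall>n. (H n \<in> unit_densities M \<and> (n = 0 \<longrightarrow> H n = h0)) \<and>
      (H (Suc n) \<in> S (H n) \<and> (\<forall>k \<in> S (H n). I (H (Suc n)) \<le> I k + (1/2)^n))"
    by (rule dependent_nat_choice) (use h0 ex in \<open>fastforce simp: S_def\<close>)+
  then obtain H where H: "\<And>n. H n \<in> unit_densities M" "H 0 = h0" "\<And>n. H (Suc n) \<in> S (H n)"
    "\<And>n k. k \<in> S (H n) \<Longrightarrow> I (H (Suc n)) \<le> I k + (1/2)^n"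
    by metis
  have Hm[measurable]: "H n \<in> borel_measurable M" and H01: "0 \<le> H n x" "H n x \<le> 1" for n x
    using H(1)[of n] by (auto simp: unit_densities_def)
  have decH: "decseq (\<lambda>n. H n x)" for x
    using H(3) by (intro decseq_SucI) (auto simp: S_def)
  have decQ: "decseq (\<lambda>n. quad_form M G (H n))"
    using H(3) by (intro decseq_SucI) (auto simp: S_def)
  define h where "h x = (INF n. H n x)" for x
  have lim: "(\<lambda>n. H n x) \<longlonglongrightarrow> h x" for x
    unfolding h_def using decH H01 by (intro LIMSEQ_decseq_INF bdd_belowI[of _ 0]) auto
  have h_le: "h x \<le> H n x" for n x
    using decseq_ge[OF decH lim] .
  have h: "h \<in> unit_densities M"
  proof -
    have "h \<in> borel_measurable M" by (rule borel_measurable_LIMSEQ_real[OF lim]) measurable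
    moreover have "0 \<le> h x" for x by (rule LIMSEQ_le_const[OF lim]) (use H01 in auto)
    moreover have "h x \<le> 1" for x using h_le[of x 0] H01[of 0 x] by linarith
    ultimately show ?thesis by (simp add: unit_densities_def)
  qed
  then have [measurable]: "h \<in> borel_measurable M" by (simp add: unit_densities_def)
  have Qlim: "(\<lambda>n. quad_form M G (H n)) \<longlonglongrightarrow> quad_form M G h"
    unfolding quad_form_def
  proof (rule integral_dominated_convergence[where w = "\<lambda>_. C"])
    note [measurable] = meas_G
    show "AE p in M \<Otimes>\<^sub>M M. norm (G (fst p) (snd p) * (H n (fst p) * H n (snd p))) \<le> C" for n
    proof (rule AE_I2)
      fix p
      have "H n (fst p) * H n (snd p) \<le> 1 * 1" using H01 by (intro mult_mono) auto
      then have "\<bar>G (fst p) (snd p)\<bar> * (H n (fst p) * H n (snd p)) \<le> C * 1"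
        using bound_G C_nonneg H01 by (intro mult_mono) auto
      then show "norm (G (fst p) (snd p) * (H n (fst p) * H n (snd p))) \<le> C"
        using H01 by (simp add: abs_mult)
    qed
    show "(\<lambda>p. G (fst p) (snd p) * (h (fst p) * h (snd p))) \<in> borel_measurable (M \<Otimes>\<^sub>M M)"
      "(\<lambda>p. G (fst p) (snd p) * (H n (fst p) * H n (snd p))) \<in> borel_measurable (M \<Otimes>\<^sub>M M)" for n
      by measurable
  qed (auto intro!: tendsto_intros lim)
  have Qh: "quad_form M G h \<le> quad_form M G (H n)" for n
    using decseq_ge[OF decQ Qlim] .
  have "AE x in M. 0 < h x \<longrightarrow> (\<integral>y. G x y * h y \<partial>M) \<le> 0"
  proof (rule ccontr)
    assume "\<not> ?thesis"
    from potential_pos_shrink[OF h this] obtain k where k: "k \<in> unit_densities M" "\<And>x. k x \<le> h x"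
      "quad_form M G k < quad_form M G h" "I k < I h"
      by (auto simp: I_def)
    \<comment> \<open>\<open>h\<close> lies below every \<open>H n\<close> both pointwise and in its
      form, so whatever improves on \<open>h\<close> is a candidate at all stages
      simultaneously.\<close>
    have kS: "k \<in> S (H n)" for n
      using k(1,3) order_trans[OF k(2) h_le] Qh[of n] by (auto simp: S_def)
    have Ih: "I h \<le> I (H n)" for n
      unfolding I_def
    proof (rule integral_mono)
      show "integrable M h" "integrable M (H n)"
        by (rule integrable_const_bound[where B = 1]; use H(1)[of n] h in \<open>simp add: unit_densities_def\<close>)+
    qed (rule h_le)
    have "I h \<le> I k + (1/2)^n" for n
      using Ih[of "Suc n"] H(4)[OF kS[of n]] by linarith
    moreover have "(\<lambda>n. I k + (1/2)^n) \<longlonglongrightarrow> I k + 0"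
      by (intro tendsto_intros LIMSEQ_power_zero) auto
    ultimately have "I h \<le> I k + 0" by (intro LIMSEQ_le_const) auto
    with k show False by simp
  qed
  with h Qh[of 0] H(2) show ?thesis by auto
qed

text \<open>If some density makes the form negative, so does the minimal one derived from it, and a
  negative form rules out zero mass. Otherwise the constant 1 already minimises the form, and
  \<open>potential_pos_shrink\<close> cannot lower it any further.\<close>

lemma nonpos_potential_density:
  assumes "0 < measure M (space M)" and "quad_form M G (\<lambda>_. 1) \<le> 0"
  shows "\<exists>h \<in> unit_densities M. 0 < (\<integral>x. h x \<partial>M) \<and>
    (AE x in M. 0 < h x \<longrightarrow> (\<integral>y. G x y * h y \<partial>M) \<le> 0)"
proof (cases "\<exists>h0 \<in> unit_densities M. quad_form M G h0 < 0")
  case True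
  then obtain h0 where "h0 \<in> unit_densities M" "quad_form M G h0 < 0" by blast
  with minimal_density obtain h where h: "h \<in> unit_densities M" "quad_form M G h < 0"
    "AE x in M. 0 < h x \<longrightarrow> (\<integral>y. G x y * h y \<partial>M) \<le> 0" by fastforce
  have hm[measurable]: "h \<in> borel_measurable M" and h01: "0 \<le> h x" "h x \<le> 1" for x
    using h by (auto simp: unit_densities_def)
  have "(\<integral>x. h x \<partial>M) \<noteq> 0"
  proof
    assume *: "(\<integral>x. h x \<partial>M) = 0"
    have "integrable M h"
      by (rule integrable_const_bound[where B = 1]) (use h01 in auto)
    then have "AE x in M. h x = 0" using integral_nonneg_eq_0_iff_AE * h01 by auto
    then have "(\<integral>x. h x * (\<integral>y. G x y * h y \<partial>M) \<partial>M) = 0"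
      by (intro integral_eq_zero_AE) auto
    then have "quad_form M G h = 0"
      unfolding quad_form_def by (subst integral_bilinear) (use h01 in \<open>auto simp: abs_le_iff intro: order_trans[of _ 0]\<close>)
    with h show False by simp
  qed
  moreover have "0 \<le> (\<integral>x. h x \<partial>M)" using h01 by simp
  ultimately show ?thesis using h by (intro bexI[of _ h]) auto
next
  case False
  have one: "(\<lambda>_. 1) \<in> unit_densities M" by (simp add: unit_densities_def)
  have "AE x in M. 0 < (1::real) \<longrightarrow> (\<integral>y. G x y * 1 \<partial>M) \<le> 0"
    using potential_pos_shrink[OF one] False assms(2) by fastforce
  then show ?thesis using one assms(1) by (intro bexI[of _ "\<lambda>_. 1"]) auto
qed

end


section \<open>Masses of short intervals and near maximisers\<close>

locale short_interval_bound = finite_measure N for N :: "real measure" +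
  fixes a s :: real
  assumes sets_N[measurable_cong, simp]: "sets N = sets borel"
    and a_pos: "0 < a"
    and short: "\<And>l. measure N {l..l + a} \<le> s"
begin

lemma measure_mono': "A \<subseteq> B \<Longrightarrow> B \<in> sets borel \<Longrightarrow> measure N A \<le> measure N B"
  by (rule finite_measure_mono) auto

text \<open>Adjacent closed pieces share an endpoint, which is harmless for an upper bound. The
  count is \<open>Suc n\<close> because a closed interval of length 0 is a point, which may carry
  mass.\<close>

lemma measure_closed_interval: "measure N {l..l + real (Suc n) * a} \<le> real (Suc n) * s"
proof (induction n)
  case 0
  then show ?case using short[of l] by simp
next
  case (Suc n)
  let ?m = "l + real (Suc n) * a"
  have eq: "l + real (Suc (Suc n)) * a = ?m + a" by (simp add: algebra_simps)
  have "{l..?m + a} \<subseteq> {l..?m} \<union> {?m..?m + a}" by auto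
  then have "measure N {l..?m + a} \<le> measure N ({l..?m} \<union> {?m..?m + a})"
    by (intro measure_mono') auto
  also have "\<dots> \<le> measure N {l..?m} + measure N {?m..?m + a}"
    by (rule measure_Un_le) auto
  also have "\<dots> \<le> real (Suc n) * s + s" using Suc short[of ?m] by linarith
  finally show ?case unfolding eq by (simp add: algebra_simps)
qed

text \<open>With one end open the interval is empty for \<open>n = 0\<close>, so this case is
  included. It occurs when \<open>k = 2\<close> in
  \<open>no_balanced_difference_measure\<close>.\<close>

lemma measure_greaterThanAtMost: "measure N {l<..l + real n * a} \<le> real n * s"
proof (cases n)
  case (Suc k)
  then show ?thesis
    using measure_closed_interval[of l k] measure_mono'[of "{l<..l + real n * a}" "{l..l + real n * a}"]
    by force
qed simp

lemma measure_atLeastLessThan: "measure N {l..<l + real n * a} \<le> real n * s"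
proof (cases n)
  case (Suc k)
  then show ?thesis
    using measure_closed_interval[of l k] measure_mono'[of "{l..<l + real n * a}" "{l..l + real n * a}"]
    by force
qed simp

end

text \<open>The hypotheses give near maximisers of arbitrarily good quality, each separated from the previous
  one by mass at least \<open>s / 2\<close>. The right-hand one is the maximum of a compact subset
  of \<open>A \<inter> {l<..l + a}\<close> obtained from inner regularity.\<close>
lemma no_rightward_propagation:
  fixes N :: "real measure" and A :: "real set"
  assumes "finite_measure N" and sN: "sets N = sets borel" and A: "A \<in> sets borel"
    and null: "measure N (- A) = 0" and a: "0 < a" and s: "0 < s" and C: "0 \<le> C"
    and start: "\<And>e. 0 < e \<Longrightarrow> \<exists>x\<in>A. s - e \<le> measure N {x - a..x + a}"
    and step: "\<And>x e. x \<in> A \<Longrightarrow> 0 < e \<Longrightarrow> C * e < s \<Longrightarrow> s - e \<le> measure N {x - a..x + a} \<Longrightarrow>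
                 \<exists>l\<ge>x. s - C * e \<le> measure N {l<..l + a}"
  shows False
proof -
  interpret finite_measure N by fact
  note [measurable_cong, simp] = sN
  have chain: "\<exists>x\<in>A. s - e \<le> measure N {x - a..x + a} \<and> real n * (s / 2) \<le> measure N {..x}"
    if "0 < e" for n e
    using that
  proof (induction n arbitrary: e)
    case 0
    then show ?case using start[of e] by auto
  next
    case (Suc n)
    \<comment> \<open>A step multiplies the error by \<open>C\<close>, so the predecessor is
      requested with the finer accuracy \<open>d\<close>; hence the induction is over all
      \<open>e\<close> at once. The bound \<open>C * d \<le> e\<close> restores the desired
      accuracy, and \<open>C * d \<le> s / 3\<close> leaves more than \<open>s / 2\<close> in the
      new interval. The \<open>+ 1\<close> guards against \<open>C = 0\<close>.\<close>
    define d where "d = min e (s / 3) / (C + 1)"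
    have d: "0 < d" using Suc.prems s C by (simp add: d_def)
    have Cd: "C * d \<le> min e (s / 3)"
    proof -
      have "C * d \<le> (C + 1) * d" using d by (simp add: algebra_simps)
      also have "\<dots> = min e (s / 3)" using C by (simp add: d_def)
      finally show ?thesis .
    qed
    obtain x where x: "x \<in> A" "s - d \<le> measure N {x - a..x + a}" "real n * (s / 2) \<le> measure N {..x}"
      using Suc.IH[OF d] by blast
    obtain l where l: "x \<le> l" "s - C * d \<le> measure N {l<..l + a}"
      using step[OF x(1) d _ x(2)] Cd s by force
    let ?J = "{l<..l + a} \<inter> A"
    have J[measurable]: "?J \<in> sets borel" using A by auto
    have "measure N {l<..l + a} \<le> measure N (?J \<union> - A)"
      using A by (intro finite_measure_mono) auto
    also have "\<dots> \<le> measure N ?J + measure N (- A)"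
      using A by (intro measure_Un_le) auto
    finally have mJ: "s / 2 < measure N ?J" using l(2) Cd s null by linarith
    have "ennreal (s / 2) < emeasure N ?J"
      using mJ s by (simp add: emeasure_eq_measure ennreal_less_iff)
    also have "emeasure N ?J = (SUP K \<in> {K. K \<subseteq> ?J \<and> compact K}. emeasure N K)"
      by (rule inner_regular) (use emeasure_finite J in auto)
    finally obtain K where K: "K \<subseteq> ?J" "compact K" "ennreal (s / 2) < emeasure N K"
      unfolding less_SUP_iff by blast
    have mK: "s / 2 < measure N K"
      using K(3) s by (simp add: emeasure_eq_measure ennreal_less_iff)
    have "K \<noteq> {}" using mK s by auto
    then obtain z where z: "z \<in> K" "\<And>y. y \<in> K \<Longrightarrow> y \<le> z"
      using compact_attains_sup[OF K(2)] by blast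
    have zA: "z \<in> A" "l < z" "z \<le> l + a" using z(1) K(1) by auto
    have "real (Suc n) * (s / 2) \<le> measure N {..x} + measure N K"
      using x(3) mK by (simp add: algebra_simps)
    also have "\<dots> = measure N ({..x} \<union> K)"
      using K l(1) by (intro finite_measure_Union[symmetric]) (auto simp: compact_imp_closed borel_closed)
    also have "\<dots> \<le> measure N {..z}"
      using z zA l(1) by (intro finite_measure_mono) auto
    finally have "real (Suc n) * (s / 2) \<le> measure N {..z}" .
    \<comment> \<open>An interval of length \<open>a\<close> is contained in the interval of radius
      \<open>a\<close> about any of its points, here \<open>z\<close>.\<close>
    moreover have "measure N {l<..l + a} \<le> measure N {z - a..z + a}"
      using zA by (intro finite_measure_mono) auto
    then have "s - e \<le> measure N {z - a..z + a}" using l(2) Cd by linarith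
    ultimately show ?case using zA by blast
  qed
  obtain n where "measure N (space N) / (s / 2) < real n"
    using reals_Archimedean2 by blast
  then have n: "measure N (space N) < real n * (s / 2)"
    using s by (simp add: field_simps)
  obtain x where "real n * (s / 2) \<le> measure N {..x}"
    using chain[OF zero_less_one, of n] by blast
  moreover have "measure N {..x} \<le> measure N (space N)" by (rule bounded_measure)
  ultimately show False using n by linarith
qed

text \<open>Although \<open>s\<close> only sees intervals centred in \<open>A\<close>, it bounds all intervals of length \<open>a\<close>:
  one of positive mass meets \<open>A\<close>.\<close>
lemma concentration_sup:
  fixes N :: "real measure" and A :: "real set"
  assumes "finite_measure N" and sN: "sets N = sets borel" and A: "A \<in> sets borel"
    and null: "measure N (- A) = 0" and a: "0 < a" and pos: "0 < measure N (space N)"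
  defines "s \<equiv> (SUP x\<in>A. measure N {x - a..x + a})"
  shows "short_interval_bound N a s" and "0 < s"
    and "\<And>x. x \<in> A \<Longrightarrow> measure N {x - a..x + a} \<le> s"
    and "\<And>e. 0 < e \<Longrightarrow> \<exists>x\<in>A. s - e \<le> measure N {x - a..x + a}"
    and "\<And>I. I \<in> sets borel \<Longrightarrow> 0 < measure N I \<Longrightarrow> I \<inter> A \<noteq> {}"
proof -
  interpret finite_measure N by fact
  note [measurable_cong, simp] = sN
  have sp: "space N = UNIV" using sets_eq_imp_space_eq[OF sN] by simp
  show meets: "I \<inter> A \<noteq> {}" if "I \<in> sets borel" "0 < measure N I" for I
  proof
    assume "I \<inter> A = {}"
    then have "measure N I \<le> measure N (- A)" using A by (intro finite_measure_mono) auto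
    with null that show False by simp
  qed
  have bdd: "bdd_above ((\<lambda>x. measure N {x - a..x + a}) ` A)"
    by (rule bdd_aboveI[of _ "measure N (space N)"]) (auto intro: bounded_measure)
  show le: "measure N {x - a..x + a} \<le> s" if "x \<in> A" for x
    unfolding s_def using that bdd by (rule cSUP_upper)
  have ne: "A \<noteq> {}" using meets[of UNIV] pos sp by auto
  show "\<exists>x\<in>A. s - e \<le> measure N {x - a..x + a}" if "0 < e" for e
  proof (rule ccontr)
    assume "\<not> ?thesis"
    then have "s \<le> s - e" unfolding s_def using ne by (intro cSUP_least) force+
    with that show False by simp
  qed
  have short: "measure N {l..l + a} \<le> s" for l
  proof (cases "measure N {l..l + a} = 0")
    case True
    obtain x where "x \<in> A" using ne by auto
    then have "0 \<le> s" using le order_trans[OF measure_nonneg] by blast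
    with True show ?thesis by simp
  next
    case False
    then have "0 < measure N {l..l + a}" by (simp add: zero_less_measure_iff)
    with meets[of "{l..l + a}"] obtain x where x: "x \<in> A" "l \<le> x" "x \<le> l + a" by auto
    then have "measure N {l..l + a} \<le> measure N {x - a..x + a}"
      by (intro finite_measure_mono) auto
    with le[OF x(1)] show ?thesis by linarith
  qed
  then show "short_interval_bound N a s"
    using a sN by unfold_locales auto
  \<comment> \<open>Otherwise all intervals of length \<open>a\<close> would be null, and countably
    many of them cover the line.\<close>
  show "0 < s"
  proof (rule ccontr)
    assume "\<not> 0 < s"
    then have "measure N {l..l + a} = 0" for l
      using short[of l] measure_nonneg[of N "{l..l + a}"] by linarith
    then have "(\<Union>i::int. {of_int i * a..of_int i * a + a}) \<in> null_sets N"
      by (intro null_sets_UN) (auto simp: null_sets_def emeasure_eq_measure)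
    moreover have "(\<Union>i::int. {of_int i * a..of_int i * a + a}) = UNIV"
    proof (intro equalityI subset_UNIV subsetI)
      fix x :: real
      have "of_int \<lfloor>x / a\<rfloor> * a \<le> x" "x \<le> of_int \<lfloor>x / a\<rfloor> * a + a"
        using a floor_divide_lower[OF a, of x] floor_divide_upper[OF a, of x] by (auto simp: algebra_simps)
      then show "x \<in> (\<Union>i::int. {of_int i * a..of_int i * a + a})" by auto
    qed
    ultimately show False using pos sp by (auto simp: null_sets_def measure_def)
  qed
qed

text \<open>Turns an almost sure inequality into one valid on all of a Borel set of full measure,
  from which near maximisers can then be selected.\<close>

lemma AE_full_measure_set:
  fixes N :: "real measure"
  assumes "finite_measure N" and sN: "sets N = sets borel" and "AE x in N. P x"
  obtains A where "A \<in> sets borel" "measure N (- A) = 0" "\<And>x. x \<in> A \<Longrightarrow> P x"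
proof -
  have sp: "space N = UNIV" using sets_eq_imp_space_eq[OF sN] by simp
  from assms(3) obtain Z where "{x \<in> space N. \<not> P x} \<subseteq> Z" "emeasure N Z = 0" "Z \<in> sets N"
    by (rule AE_E)
  then show thesis by (intro that[of "- Z"]) (auto simp: sp sN measure_def)
qed

section \<open>Contradictions from pointwise inequalities between interval masses\<close>

text \<open>About a near maximiser \<open>x\<close>, the large interval consists of the centre
  \<open>{x - a..x + a}\<close> and \<open>k - 1\<close> short intervals on each side, which makes
  \<open>2 * k - 1\<close> pieces of mass at most \<open>s\<close>. Their total is at least
  \<open>(2 * k - 1) * (s - e)\<close>, so the piece just right of the centre, present since
  \<open>2 \<le> k\<close>, has mass at least \<open>s - (2 * k - 1) * e\<close>.\<close>

lemma no_balanced_difference_measure: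
  fixes N :: "real measure"
  assumes fin: "finite_measure N" and sN: "sets N = sets borel" and pos: "0 < measure N (space N)"
    and a: "0 < a" and k: "2 \<le> k"
    and le: "AE x in N. (2 * real k - 1) * measure N {x - a..x + a}
                \<le> measure N {x - real k * a..x + real k * a}"
  shows False
proof -
  interpret finite_measure N by fact
  note [measurable_cong, simp] = sN
  obtain A where A: "A \<in> sets borel" "measure N (- A) = 0"
    and leA: "\<And>x. x \<in> A \<Longrightarrow> (2 * real k - 1) * measure N {x - a..x + a}
                \<le> measure N {x - real k * a..x + real k * a}"
    using AE_full_measure_set[OF fin sN le] by blast
  define s where "s = (SUP x\<in>A. measure N {x - a..x + a})"
  note sup = concentration_sup[OF fin sN A a pos, folded s_def]
  interpret short_interval_bound N a s by (rule sup)
  show False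
  proof (rule no_rightward_propagation[OF fin sN A a sup(2) _ sup(4), of "2 * real k - 1"])
    fix x e assume x: "x \<in> A" and e: "s - e \<le> measure N {x - a..x + a}"
    obtain j where j: "k = j + 2" using k by (metis add.commute le_Suc_ex)
    let ?L = "{x - real k * a..<x - a}" and ?M = "{x - a..x + a}" and ?J = "{x + a<..x + a + a}"
      and ?R = "{x + 2 * a<..x + real k * a}"
    have "{x - real k * a..x + real k * a} \<subseteq> ?L \<union> ?M \<union> ?J \<union> ?R" using a by auto
    then have "measure N {x - real k * a..x + real k * a} \<le> measure N (?L \<union> ?M \<union> ?J \<union> ?R)"
      by (intro finite_measure_mono) auto
    also have "\<dots> \<le> measure N ?L + measure N ?M + measure N ?J + measure N ?R"
      by (rule order_trans[OF measure_Un_le] add_right_mono order_refl; (simp; fail)?)+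
    finally have "(2 * real k - 1) * measure N ?M \<le> measure N ?L + measure N ?M + measure N ?J + measure N ?R"
      using leA[OF x] by linarith
    moreover have "measure N ?L \<le> (real k - 1) * s"
      using measure_atLeastLessThan[of "x - real k * a" "j + 1"] by (simp add: j algebra_simps)
    moreover have "measure N ?R \<le> (real k - 2) * s"
      using measure_greaterThanAtMost[of "x + 2 * a" j] by (simp add: j algebra_simps)
    moreover have "measure N ?M \<le> s" by (rule sup(3)[OF x])
    moreover have "(2 * real k - 1) * (s - e) \<le> (2 * real k - 1) * measure N ?M"
      using e k by (intro mult_left_mono) auto
    ultimately have "s - (2 * real k - 1) * e \<le> measure N ?J" by (simp add: algebra_simps)
    then show "\<exists>l\<ge>x. s - (2 * real k - 1) * e \<le> measure N {l<..l + a}"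
      using a by (intro exI[of _ "x + a"]) auto
  qed (use k in auto)
qed

text \<open>The interval about \<open>- x\<close> has length \<open>m * a\<close>, so it splits into
  \<open>m\<close> short ones, and near maximality at \<open>x\<close> forces both extreme ones to
  have mass close to \<open>s\<close>. As the reflection reverses direction, it is applied twice:
  the leftmost piece about \<open>- x\<close> contains a near maximiser \<open>y\<close>, and the
  rightmost piece about \<open>- y\<close> lies to the right of \<open>x\<close>. Each reflection
  costs a factor \<open>m\<close> in the error.\<close>

lemma no_balanced_sum_measure:
  fixes N :: "real measure"
  assumes fin: "finite_measure N" and sN: "sets N = sets borel" and pos: "0 < measure N (space N)"
    and a: "0 < a" and m: "2 \<le> m"
    and le: "AE x in N. real m * measure N {x - a..x + a}
                \<le> measure N {- x - real m * a / 2..- x + real m * a / 2}"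
  shows False
proof -
  interpret finite_measure N by fact
  note [measurable_cong, simp] = sN
  obtain A where A: "A \<in> sets borel" "measure N (- A) = 0"
    and leA: "\<And>x. x \<in> A \<Longrightarrow> real m * measure N {x - a..x + a}
                \<le> measure N {- x - real m * a / 2..- x + real m * a / 2}"
    using AE_full_measure_set[OF fin sN le] by blast
  define s where "s = (SUP x\<in>A. measure N {x - a..x + a})"
  note sup = concentration_sup[OF fin sN A a pos, folded s_def]
  interpret short_interval_bound N a s by (rule sup)
  obtain j where j: "m = j + 2" using m by (metis add.commute le_Suc_ex)
  have ma: "2 * a \<le> real m * a" using m a by simp
  have leftmost: "s - real m * e \<le> measure N {- x - real m * a / 2..<- x - real m * a / 2 + a}"
    and rightmost: "s - real m * e \<le> measure N {- x + real m * a / 2 - a<..- x + real m * a / 2}"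
    if x: "x \<in> A" and e: "s - e \<le> measure N {x - a..x + a}" for x e
  proof -
    let ?l = "- x - real m * a / 2" and ?r = "- x + real m * a / 2"
    have *: "real m * (s - e) \<le> measure N {?l..?r}"
      using mult_left_mono[OF e, of "real m"] leA[OF x] by linarith
    have rl: "?r = ?l + a + real (Suc j) * a" by (simp add: j field_simps)
    have "{?l..?r} \<subseteq> {?l..<?l + a} \<union> {?l + a..?r}" by auto
    then have "measure N {?l..?r} \<le> measure N ({?l..<?l + a} \<union> {?l + a..?r})"
      by (intro finite_measure_mono) auto
    also have "\<dots> \<le> measure N {?l..<?l + a} + measure N {?l + a..?r}"
      by (rule measure_Un_le) auto
    also have "measure N {?l + a..?r} \<le> real (Suc j) * s"
      unfolding rl by (rule measure_closed_interval)
    finally show "s - real m * e \<le> measure N {?l..<?l + a}"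
      using * by (simp add: j algebra_simps)
    have rl': "?r - a = ?l + real (Suc j) * a" by (simp add: j field_simps)
    have "{?l..?r} \<subseteq> {?l..?r - a} \<union> {?r - a<..?r}" by auto
    then have "measure N {?l..?r} \<le> measure N ({?l..?r - a} \<union> {?r - a<..?r})"
      by (intro finite_measure_mono) auto
    also have "\<dots> \<le> measure N {?l..?r - a} + measure N {?r - a<..?r}"
      by (rule measure_Un_le) auto
    also have "measure N {?l..?r - a} \<le> real (Suc j) * s"
      unfolding rl' by (rule measure_closed_interval)
    finally show "s - real m * e \<le> measure N {?r - a<..?r}"
      using * by (simp add: j algebra_simps)
  qed
  show False
  proof (rule no_rightward_propagation[OF fin sN A a sup(2) _ sup(4), of "real m * real m"])
    fix x e assume x: "x \<in> A" and e0: "0 < e" and small: "real m * real m * e < s"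
      and e: "s - e \<le> measure N {x - a..x + a}"
    let ?J = "{- x - real m * a / 2..<- x - real m * a / 2 + a}"
    have J: "s - real m * e \<le> measure N ?J" by (rule leftmost[OF x e])
    \<comment> \<open>The smallness of \<open>e\<close> makes \<open>?J\<close> a set of positive
      mass, so it contains a point \<open>y\<close> of \<open>A\<close>.\<close>
    have "real m * e \<le> real m * (real m * e)" using m e0 by simp
    then have "0 < measure N ?J" using J small by (simp add: mult.assoc)
    with sup(5)[of ?J] obtain y where y: "y \<in> A" "- x - real m * a / 2 \<le> y" "y < - x - real m * a / 2 + a"
      by auto
    have "measure N ?J \<le> measure N {y - a..y + a}"
      using y a by (intro finite_measure_mono) auto
    then have "s - real m * e \<le> measure N {y - a..y + a}" using J by linarith
    from rightmost[OF y(1) this] have "s - real m * real m * e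
        \<le> measure N {- y + real m * a / 2 - a<..- y + real m * a / 2 - a + a}"
      by (simp add: mult.assoc)
    \<comment> \<open>The left end of the new interval exceeds \<open>x\<close> by more than
      \<open>m * a - 2 * a\<close>, which is nonnegative because \<open>2 \<le> m\<close>.\<close>
    moreover have "x \<le> - y + real m * a / 2 - a" using y ma by linarith
    ultimately show "\<exists>l\<ge>x. s - real m * real m * e \<le> measure N {l<..l + a}" by blast
  qed auto
qed


section \<open>One-dimensional inequalities for two independent copies\<close>

text \<open>The assumed inequality says that the form of the kernel
  \<open>K * of_bool (P x y) - of_bool (Q x y)\<close> is nonpositive at the constant 1. Reweighting
  \<open>N\<close> by the density from \<open>nonpos_potential_density\<close> turns this averaged
  inequality into one that holds at almost every point of the new measure.\<close>

lemma density_of_violation: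
  fixes N :: "real measure" and P Q :: "real \<Rightarrow> real \<Rightarrow> bool" and K :: real
  assumes "prob_space N" and sN: "sets N = sets borel"
    and mP: "{p. P (fst p) (snd p)} \<in> sets (borel \<Otimes>\<^sub>M borel)"
    and mQ: "{p. Q (fst p) (snd p)} \<in> sets (borel \<Otimes>\<^sub>M borel)"
    and sP: "\<And>x y. P x y = P y x" and sQ: "\<And>x y. Q x y = Q y x"
    and le: "K * measure (N \<Otimes>\<^sub>M N) {p. P (fst p) (snd p)} \<le> measure (N \<Otimes>\<^sub>M N) {p. Q (fst p) (snd p)}"
  shows "\<exists>N'. finite_measure N' \<and> sets N' = sets borel \<and> 0 < measure N' (space N') \<and>
    (AE x in N'. K * measure N' {y. P x y} \<le> measure N' {y. Q x y})"
proof -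
  interpret prob_space N by fact
  note [measurable_cong, simp] = sN
  have sp[simp]: "space N = UNIV" using sets_eq_imp_space_eq[OF sN] by simp
  have sNN: "sets (N \<Otimes>\<^sub>M N) = sets (borel \<Otimes>\<^sub>M borel)"
    by (rule sets_pair_measure_cong) auto
  define G where "G x y = K * of_bool (P x y) - of_bool (Q x y)" for x y
  have G_ind: "G (fst p) (snd p) = K * indicator {p. P (fst p) (snd p)} p - indicator {p. Q (fst p) (snd p)} p"
    for p by (simp add: G_def)
  interpret bounded_kernel N G "\<bar>K\<bar> + 1"
  proof
    show "(\<lambda>p. G (fst p) (snd p)) \<in> borel_measurable (N \<Otimes>\<^sub>M N)"
      unfolding G_ind using mP mQ sNN by measurable
  qed (auto simp: G_def sP sQ)
  have "quad_form N G (\<lambda>_. 1) \<le> 0"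
    unfolding quad_form_def G_ind using mP mQ sNN le
    by (simp add: space_pair_measure prod.emeasure_finite less_top[symmetric])
  then obtain h where h: "h \<in> unit_densities N" "0 < (\<integral>x. h x \<partial>N)"
      "AE x in N. 0 < h x \<longrightarrow> (\<integral>y. G x y * h y \<partial>N) \<le> 0"
    using nonpos_potential_density prob_space by auto
  have hm[measurable]: "h \<in> borel_measurable N" and h01: "0 \<le> h x" "h x \<le> 1" for x
    using h by (auto simp: unit_densities_def)
  have int_h: "integrable N h"
    by (rule integrable_const_bound[where B = 1]) (use h01 in auto)
  let ?D = "density N h"
  have meas_D: "measure ?D B = (\<integral>x. indicator B x * h x \<partial>N)" if "B \<in> sets borel" for B
  proof -
    have "measure ?D B = (\<integral>x. indicator B x \<partial>?D)" by simp
    also have "\<dots> = (\<integral>x. h x * indicator B x \<partial>N)"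
      using h01 that by (intro integral_real_density) auto
    finally show ?thesis by (simp add: mult.commute)
  qed
  have sections: "{y. P x y} \<in> sets borel" "{y. Q x y} \<in> sets borel" for x
    using sets_Pair1[OF mP, of x] sets_Pair1[OF mQ, of x] by (simp_all add: vimage_def)
  have "(\<integral>y. G x y * h y \<partial>N) = K * measure ?D {y. P x y} - measure ?D {y. Q x y}" for x
  proof -
    have i: "integrable N (\<lambda>y. indicator B y * h y)" if "B \<in> sets borel" for B
      using that by (intro integrable_const_bound[where B = 1]) (auto simp: h01 indicator_def)
    have "(\<integral>y. G x y * h y \<partial>N)
        = (\<integral>y. K * (indicator {y. P x y} y * h y) - indicator {y. Q x y} y * h y \<partial>N)"
      by (intro Bochner_Integration.integral_cong refl) (simp add: G_def indicator_def algebra_simps)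
    then show ?thesis using i[OF sections(1)] i[OF sections(2)] by (simp add: meas_D sections)
  qed
  then have "AE x in N. 0 < h x \<longrightarrow> K * measure ?D {y. P x y} \<le> measure ?D {y. Q x y}"
    using h(3) by simp
  \<comment> \<open>Almost everywhere for the density measure means almost everywhere for
    \<open>N\<close> on the set where \<open>h\<close> is positive, which is exactly where the
    potential is controlled.\<close>
  then have "AE x in ?D. K * measure ?D {y. P x y} \<le> measure ?D {y. Q x y}"
    by (subst AE_density) auto
  moreover have "finite_measure ?D"
    using int_h h01 by (intro finite_measureI) (simp add: emeasure_density nn_integral_eq_integral)
  moreover have "0 < measure ?D (space ?D)"
    using h(2) by (simp add: meas_D)
  ultimately show ?thesis by (intro exI[of _ ?D]) auto
qed

lemma sets_abs_le [measurable, simp]: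
  "{p :: real \<times> real. \<bar>fst p - snd p\<bar> \<le> c} \<in> sets (borel \<Otimes>\<^sub>M borel)"
  "{p :: real \<times> real. \<bar>fst p + snd p\<bar> \<le> c} \<in> sets (borel \<Otimes>\<^sub>M borel)"
proof -
  have "{p \<in> space (borel \<Otimes>\<^sub>M borel). \<bar>fst p - snd p :: real\<bar> \<le> c} \<in> sets (borel \<Otimes>\<^sub>M borel)"
    "{p \<in> space (borel \<Otimes>\<^sub>M borel). \<bar>fst p + snd p :: real\<bar> \<le> c} \<in> sets (borel \<Otimes>\<^sub>M borel)"
    by measurable
  then show "{p :: real \<times> real. \<bar>fst p - snd p\<bar> \<le> c} \<in> sets (borel \<Otimes>\<^sub>M borel)"
    "{p :: real \<times> real. \<bar>fst p + snd p\<bar> \<le> c} \<in> sets (borel \<Otimes>\<^sub>M borel)"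
    by (simp_all add: space_pair_measure)
qed

text \<open>Enlarging \<open>b\<close> to \<open>k * a\<close> with
  \<open>k = \<lceil>b / a\<rceil>\<close> keeps the factor and can only increase the left side, so
  a violation persists. The assumption \<open>a < b\<close> yields \<open>2 \<le> k\<close>; for
  \<open>a = b\<close> the two sides coincide.\<close>

lemma prob_abs_diff_less:
  fixes N :: "real measure"
  assumes "prob_space N" and sN: "sets N = sets borel" and a: "0 < a" and ab: "a < b"
  shows "measure (N \<Otimes>\<^sub>M N) {p. \<bar>fst p - snd p\<bar> \<le> b}
    < (2 * real_of_int \<lceil>b / a\<rceil> - 1) * measure (N \<Otimes>\<^sub>M N) {p. \<bar>fst p - snd p\<bar> \<le> a}"
proof (rule ccontr)
  assume neg: "\<not> ?thesis"
  have sNN: "sets (N \<Otimes>\<^sub>M N) = sets (borel \<Otimes>\<^sub>M borel)"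
    using sN by (intro sets_pair_measure_cong) auto
  interpret prob_space N by fact
  interpret P: pair_prob_space N N ..
  define k where "k = nat \<lceil>b / a\<rceil>"
  have "1 < b / a" using a ab by simp
  then have k: "2 \<le> k" "real_of_int \<lceil>b / a\<rceil> = real k"
    unfolding k_def by linarith+
  have "b / a \<le> real k" using le_of_int_ceiling[of "b / a"] k(2) by simp
  then have bk: "b \<le> real k * a" using a by (simp add: field_simps)
  have "measure (N \<Otimes>\<^sub>M N) {p. \<bar>fst p - snd p\<bar> \<le> b}
      \<le> measure (N \<Otimes>\<^sub>M N) {p. \<bar>fst p - snd p\<bar> \<le> real k * a}"
    using bk by (intro P.finite_measure_mono) (auto simp: sNN)
  with neg have le: "(2 * real k - 1) * measure (N \<Otimes>\<^sub>M N) {p. \<bar>fst p - snd p\<bar> \<le> a}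
      \<le> measure (N \<Otimes>\<^sub>M N) {p. \<bar>fst p - snd p\<bar> \<le> real k * a}"
    by (simp add: k(2))
  obtain N' where N': "finite_measure N'" "sets N' = sets borel" "0 < measure N' (space N')"
    "AE x in N'. (2 * real k - 1) * measure N' {y. \<bar>x - y\<bar> \<le> a} \<le> measure N' {y. \<bar>x - y\<bar> \<le> real k * a}"
    using density_of_violation[OF assms(1) sN _ _ _ _ le] by (auto simp: abs_minus_commute)
  moreover have "{y. \<bar>x - y\<bar> \<le> c} = {x - c..x + c}" for x c :: real by auto
  ultimately show False
    using no_balanced_difference_measure[OF N'(1-3) a k(1)] by simp
qed

text \<open>The same rounding with \<open>m = \<lceil>2 * b / a\<rceil>\<close>: the radius becomes
  \<open>m * a / 2\<close>, and \<open>a / 2 < b\<close> is what gives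
  \<open>2 \<le> m\<close>.\<close>

lemma prob_abs_sum_less:
  fixes N :: "real measure"
  assumes "prob_space N" and sN: "sets N = sets borel" and a: "0 < a" and ab: "a / 2 < b"
  shows "measure (N \<Otimes>\<^sub>M N) {p. \<bar>fst p + snd p\<bar> \<le> b}
    < real_of_int \<lceil>2 * b / a\<rceil> * measure (N \<Otimes>\<^sub>M N) {p. \<bar>fst p - snd p\<bar> \<le> a}"
proof (rule ccontr)
  assume neg: "\<not> ?thesis"
  have sNN: "sets (N \<Otimes>\<^sub>M N) = sets (borel \<Otimes>\<^sub>M borel)"
    using sN by (intro sets_pair_measure_cong) auto
  interpret prob_space N by fact
  interpret P: pair_prob_space N N ..
  define m where "m = nat \<lceil>2 * b / a\<rceil>"
  have "1 < 2 * b / a" using a ab by (simp add: field_simps)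
  then have m: "2 \<le> m" "real_of_int \<lceil>2 * b / a\<rceil> = real m"
    unfolding m_def by linarith+
  have "2 * b / a \<le> real m" using le_of_int_ceiling[of "2 * b / a"] m(2) by simp
  define c where "c = real m * a / 2"
  have bm: "b \<le> c" using a \<open>2 * b / a \<le> real m\<close> by (simp add: c_def field_simps)
  have "measure (N \<Otimes>\<^sub>M N) {p. \<bar>fst p + snd p\<bar> \<le> b}
      \<le> measure (N \<Otimes>\<^sub>M N) {p. \<bar>fst p + snd p\<bar> \<le> c}"
    using bm by (intro P.finite_measure_mono) (auto simp: sNN)
  with neg have le: "real m * measure (N \<Otimes>\<^sub>M N) {p. \<bar>fst p - snd p\<bar> \<le> a}
      \<le> measure (N \<Otimes>\<^sub>M N) {p. \<bar>fst p + snd p\<bar> \<le> c}"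
    by (simp add: m(2))
  obtain N' where N': "finite_measure N'" "sets N' = sets borel" "0 < measure N' (space N')"
    "AE x in N'. real m * measure N' {y. \<bar>x - y\<bar> \<le> a} \<le> measure N' {y. \<bar>x + y\<bar> \<le> c}"
    using density_of_violation[OF assms(1) sN _ _ _ _ le] by (auto simp: abs_minus_commute add.commute)
  moreover have "{y. \<bar>x - y\<bar> \<le> c} = {x - c..x + c}" "{y. \<bar>x + y\<bar> \<le> c} = {- x - c..- x + c}"
    for x c :: real by auto
  ultimately show False
    using no_balanced_sum_measure[OF N'(1-3) a m(1), folded c_def] by simp
qed

section \<open>Factorisation over coordinates and the theorem in all dimensions\<close>

lemma borel_measurable_vec_nth [measurable]: "(\<lambda>x :: real ^ 'n. x $ i) \<in> borel_measurable borel"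
  by (intro borel_measurable_continuous_onI continuous_intros)

text \<open>Conditioning on \<open>X\<close> and using the independence of the coordinates of \<open>Y\<close> and then of \<open>X\<close>
  avoids the joint independence of the pairs \<open>(X $ i, Y $ i)\<close>.\<close>
lemma prob_all_coordinates:
  fixes M :: "'s measure" and X Y :: "'s \<Rightarrow> real ^ 'n" and P :: "real \<Rightarrow> real \<Rightarrow> bool"
  assumes "prob_space M"
    and indep: "prob_space.indep_var M borel X borel Y"
    and eq: "distr M borel X = distr M borel Y"
    and X: "prob_space.indep_vars M (\<lambda>_. borel) (\<lambda>i \<omega>. X \<omega> $ i) UNIV"
    and Y: "prob_space.indep_vars M (\<lambda>_. borel) (\<lambda>i \<omega>. Y \<omega> $ i) UNIV"
    and mP: "{p. P (fst p) (snd p)} \<in> sets (borel \<Otimes>\<^sub>M borel)"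
  defines "N \<equiv> \<lambda>i. distr M borel (\<lambda>\<omega>. X \<omega> $ i)"
  shows "\<P>(\<omega> in M. \<forall>i. P (X \<omega> $ i) (Y \<omega> $ i)) = (\<Prod>i\<in>UNIV. measure (N i \<Otimes>\<^sub>M N i) {p. P (fst p) (snd p)})"
proof -
  interpret prob_space M by fact
  have [measurable]: "X \<in> borel_measurable M" "Y \<in> borel_measurable M"
    and joint: "distr M borel X \<Otimes>\<^sub>M distr M borel Y = distr M (borel \<Otimes>\<^sub>M borel) (\<lambda>\<omega>. (X \<omega>, Y \<omega>))"
    using indep unfolding indep_var_distribution_eq by auto
  have pm[measurable]: "Measurable.pred (borel \<Otimes>\<^sub>M borel) (\<lambda>p. P (fst p) (snd p))"
    using mP by (simp add: pred_def space_pair_measure)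
  have [measurable]: "Measurable.pred M (\<lambda>\<omega>. P (X \<omega> $ i) (Y \<omega> $ i))" for i
    using measurable_compose[OF measurable_Pair[of "\<lambda>\<omega>. X \<omega> $ i" M borel "\<lambda>\<omega>. Y \<omega> $ i" borel] pm] by simp
  interpret DY: prob_space "distr M borel Y" by (rule prob_space_distr) simp
  interpret N: prob_space "N i" for i unfolding N_def by (rule prob_space_distr) simp
  interpret NN: pair_prob_space "N i" "N i" for i ..
  have N_Y: "N i = distr M borel (\<lambda>\<omega>. Y \<omega> $ i)" for i
  proof -
    have "N i = distr (distr M borel X) borel (\<lambda>x. x $ i)"
      unfolding N_def by (subst distr_distr) (auto simp: comp_def)
    also have "\<dots> = distr M borel (\<lambda>\<omega>. Y \<omega> $ i)"
      unfolding eq by (subst distr_distr) (auto simp: comp_def)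
    finally show ?thesis .
  qed
  have sN: "sets (N i) = sets borel" for i by (simp add: N_def)
  then have sNN: "sets (N i \<Otimes>\<^sub>M N i) = sets (borel \<Otimes>\<^sub>M borel)" for i
    by (intro sets_pair_measure_cong) auto
  note [measurable_cong] = sN
  let ?S = "{p. P (fst p) (snd p)}"
  let ?f = "\<lambda>x y. indicator ?S (x, y) :: ennreal"
  have fm[measurable]: "(\<lambda>p. ?f (fst p) (snd p)) \<in> borel_measurable (borel \<Otimes>\<^sub>M borel)"
    using mP by simp
  have fm2[measurable]: "(\<lambda>\<omega>. ?f (f \<omega>) (g \<omega>)) \<in> borel_measurable L"
    if "f \<in> borel_measurable L" "g \<in> borel_measurable L" for L :: "'c measure" and f g
    using measurable_compose[OF measurable_Pair[OF that] fm] by simp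
  \<comment> \<open>\<open>\<phi> i x\<close> is the probability that \<open>P x\<close> holds of
    coordinate \<open>i\<close> of \<open>Y\<close>. Being a function of the single coordinate
    \<open>x\<close>, it lets the independence of the coordinates of \<open>X\<close> be applied
    after that of \<open>Y\<close>.\<close>
  define \<phi> where "\<phi> i x = (\<integral>\<^sup>+y. ?f x y \<partial>N i)" for i x
  have [measurable]: "\<phi> i \<in> borel_measurable borel" for i
    unfolding \<phi>_def by measurable
  have "emeasure M {\<omega> \<in> space M. \<forall>i. P (X \<omega> $ i) (Y \<omega> $ i)}
      = (\<integral>\<^sup>+\<omega>. indicator {\<omega> \<in> space M. \<forall>i. P (X \<omega> $ i) (Y \<omega> $ i)} \<omega> \<partial>M)"
    by (subst nn_integral_indicator) auto
  also have "\<dots> = (\<integral>\<^sup>+\<omega>. (\<Prod>i\<in>UNIV. ?f (X \<omega> $ i) (Y \<omega> $ i)) \<partial>M)"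
    by (intro nn_integral_cong) (auto simp: indicator_def intro!: prod_zero)
  also have "\<dots> = (\<integral>\<^sup>+p. (\<Prod>i\<in>UNIV. ?f (fst p $ i) (snd p $ i)) \<partial>distr M (borel \<Otimes>\<^sub>M borel) (\<lambda>\<omega>. (X \<omega>, Y \<omega>)))"
    by (subst nn_integral_distr) auto
  also have "\<dots> = (\<integral>\<^sup>+x. \<integral>\<^sup>+y. (\<Prod>i\<in>UNIV. ?f (x $ i) (y $ i)) \<partial>distr M borel Y \<partial>distr M borel X)"
    unfolding joint[symmetric] by (subst DY.nn_integral_fst[symmetric]) auto
  also have "\<dots> = (\<integral>\<^sup>+\<omega>. \<integral>\<^sup>+\<omega>'. (\<Prod>i\<in>UNIV. ?f (X \<omega> $ i) (Y \<omega>' $ i)) \<partial>M \<partial>M)"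
    by (simp add: nn_integral_distr)
  also have "\<dots> = (\<integral>\<^sup>+\<omega>. (\<Prod>i\<in>UNIV. \<integral>\<^sup>+\<omega>'. ?f (X \<omega> $ i) (Y \<omega>' $ i) \<partial>M) \<partial>M)"
    by (intro nn_integral_cong indep_vars_nn_integral indep_vars_compose2[OF Y]) auto
  also have "\<dots> = (\<integral>\<^sup>+\<omega>. (\<Prod>i\<in>UNIV. \<integral>\<^sup>+y. ?f (X \<omega> $ i) y \<partial>N i) \<partial>M)"
    unfolding N_Y by (simp add: nn_integral_distr)
  also have "\<dots> = (\<Prod>i\<in>UNIV. \<integral>\<^sup>+\<omega>. \<phi> i (X \<omega> $ i) \<partial>M)"
    unfolding \<phi>_def[symmetric] by (intro indep_vars_nn_integral indep_vars_compose2[OF X]) auto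
  also have "\<dots> = (\<Prod>i\<in>UNIV. \<integral>\<^sup>+x. \<phi> i x \<partial>N i)"
    by (intro prod.cong refl) (subst N_def, subst nn_integral_distr, auto)
  also have "\<dots> = (\<Prod>i\<in>UNIV. emeasure (N i \<Otimes>\<^sub>M N i) ?S)"
    unfolding \<phi>_def using mP sNN by (intro prod.cong refl N.emeasure_pair_measure[symmetric]) simp
  finally show ?thesis
    by (simp add: emeasure_eq_measure NN.emeasure_eq_measure prod_ennreal prod_nonneg)
qed

lemma infnorm_le_iff_cart: "infnorm (x :: real ^ 'n) \<le> c \<longleftrightarrow> (\<forall>i. \<bar>x $ i\<bar> \<le> c)"
proof
  assume "infnorm x \<le> c"
  then show "\<forall>i. \<bar>x $ i\<bar> \<le> c" using component_le_infnorm_cart order_trans by blast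
next
  assume "\<forall>i. \<bar>x $ i\<bar> \<le> c"
  then show "infnorm x \<le> c" unfolding infnorm_cart by (intro cSup_least) auto
qed

theorem corollary2:
  fixes M :: "'s measure" and X Y :: "'s \<Rightarrow> real ^ 'n"
  assumes "prob_space M"
    and "prob_space.indep_var M borel X borel Y"
    and "distr M borel X = distr M borel Y"
    and "prob_space.indep_vars M (\<lambda>_. borel) (\<lambda>i \<omega>. X \<omega> $ i) UNIV"
    and "prob_space.indep_vars M (\<lambda>_. borel) (\<lambda>i \<omega>. Y \<omega> $ i) UNIV"
  shows "(\<forall>a b :: real. 0 < a / 2 \<and> a / 2 < b \<longrightarrow>
            \<P>(\<omega> in M. infnorm (X \<omega> + Y \<omega>) \<le> b)
              < (real_of_int \<lceil>2 * b / a\<rceil>) ^ CARD('n) * \<P>(\<omega> in M. infnorm (X \<omega> - Y \<omega>) \<le> a)) \<and>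
         (\<forall>a b :: real. 0 < a \<and> 0 < b \<longrightarrow>
            \<P>(\<omega> in M. infnorm (X \<omega> - Y \<omega>) \<le> b)
              \<le> (2 * real_of_int \<lceil>b / a\<rceil> - 1) ^ CARD('n) * \<P>(\<omega> in M. infnorm (X \<omega> - Y \<omega>) \<le> a) \<and>
            (a < b \<longrightarrow>
            \<P>(\<omega> in M. infnorm (X \<omega> - Y \<omega>) \<le> b)
              < (2 * real_of_int \<lceil>b / a\<rceil> - 1) ^ CARD('n) * \<P>(\<omega> in M. infnorm (X \<omega> - Y \<omega>) \<le> a)))"
proof -
  interpret prob_space M by fact
  define N where "N i = distr M borel (\<lambda>\<omega>. X \<omega> $ i)" for i
  have [measurable]: "X \<in> borel_measurable M" "Y \<in> borel_measurable M"
    using assms(2) unfolding indep_var_distribution_eq by auto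
  have N: "prob_space (N i)" "sets (N i) = sets borel" for i
    unfolding N_def by (auto intro!: prob_space_distr)
  define D S where "D c i = measure (N i \<Otimes>\<^sub>M N i) {p. \<bar>fst p - snd p\<bar> \<le> c}"
    and "S c i = measure (N i \<Otimes>\<^sub>M N i) {p. \<bar>fst p + snd p\<bar> \<le> c}" for c i
  note coords = prob_all_coordinates[OF assms, folded N_def]
  have diff: "\<P>(\<omega> in M. infnorm (X \<omega> - Y \<omega>) \<le> c) = (\<Prod>i\<in>UNIV. D c i)" for c
    using coords[of "\<lambda>x y. \<bar>x - y\<bar> \<le> c"] by (simp add: infnorm_le_iff_cart D_def)
  have sum: "\<P>(\<omega> in M. infnorm (X \<omega> + Y \<omega>) \<le> c) = (\<Prod>i\<in>UNIV. S c i)" for c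
    using coords[of "\<lambda>x y. \<bar>x + y\<bar> \<le> c"] by (simp add: infnorm_le_iff_cart S_def)
  have less: "(\<Prod>i\<in>UNIV. f i) < K ^ CARD('n) * (\<Prod>i\<in>UNIV. g i)"
    if "\<And>i. 0 \<le> f i" "\<And>i. f i < K * g i" for f g :: "'n \<Rightarrow> real" and K
  proof -
    \<comment> \<open>Strictness in one factor suffices once all majorants are positive, and
      \<open>K * g i\<close> exceeds \<open>f i \<ge> 0\<close>. An index exists because the type
      \<open>'n\<close> is inhabited, so \<open>undefined\<close> serves.\<close>
    have "(\<Prod>i\<in>UNIV. f i) < (\<Prod>i\<in>UNIV. K * g i)"
      using that by (intro prod_mono_strict[of undefined]) (auto intro: less_imp_le le_less_trans)
    then show ?thesis by (simp add: prod.distrib)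
  qed
  have strict: "\<P>(\<omega> in M. infnorm (X \<omega> - Y \<omega>) \<le> b)
      < (2 * real_of_int \<lceil>b / a\<rceil> - 1) ^ CARD('n) * \<P>(\<omega> in M. infnorm (X \<omega> - Y \<omega>) \<le> a)"
    if "0 < a" "a < b" for a b
    unfolding diff using prob_abs_diff_less[OF N that] by (intro less) (auto simp: D_def)
  moreover have "\<P>(\<omega> in M. infnorm (X \<omega> - Y \<omega>) \<le> b)
      \<le> (2 * real_of_int \<lceil>b / a\<rceil> - 1) ^ CARD('n) * \<P>(\<omega> in M. infnorm (X \<omega> - Y \<omega>) \<le> a)"
    if "0 < a" "0 < b" for a b
  proof (cases "a < b")
    \<comment> \<open>For \<open>b \<le> a\<close> the ceiling is 1, hence so is the whole factor,
      and only monotonicity in the radius remains; at \<open>a = b\<close> this is an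
      equality.\<close>
    case False
    have "\<lceil>b / a\<rceil> = 1" using that False by (simp add: ceiling_eq_iff)
    moreover have "\<P>(\<omega> in M. infnorm (X \<omega> - Y \<omega>) \<le> b) \<le> \<P>(\<omega> in M. infnorm (X \<omega> - Y \<omega>) \<le> a)"
      unfolding infnorm_le_iff_cart using False
      by (intro finite_measure_mono) (auto intro: order_trans)
    ultimately show ?thesis by simp
  qed (use strict that in \<open>auto intro: less_imp_le\<close>)
  moreover have "\<P>(\<omega> in M. infnorm (X \<omega> + Y \<omega>) \<le> b)
      < (real_of_int \<lceil>2 * b / a\<rceil>) ^ CARD('n) * \<P>(\<omega> in M. infnorm (X \<omega> - Y \<omega>) \<le> a)"
    if "0 < a" "a / 2 < b" for a b
    unfolding diff sum using prob_abs_sum_less[OF N that] by (intro less) (auto simp: S_def D_def)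
  ultimately show ?thesis by auto
qed

end
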